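(* Let $S=S(\lambda_1,\ldots,\lambda_d)$ be a spider with $n=1+\lambda_1+\cdots+\lambda_d$ vertices and $d\ge 5$ legs. If $S$ is $e$-positive, then $$\sum_{k=1}^{d-3}\left(\frac{n}{2}\right)^{-1/2^{k}}<1 .$$
   Context: A spider $S(\lambda_1,\ldots,\lambda_d)$, for positive integers $\lambda_1\ge\cdots\ge\lambda_d$, is the tree consisting of a vertex $v$ (the center) together with $d$ vertex-disjoint paths (legs) having $\lambda_1,\ldots,\lambda_d$ vertices respectively, where $v$ is joined by an edge to one endpoint of each leg. The chromatic symmetric function of a graph $G$ is $X_G=\sum_\kappa \prod_{v} x_{\kappa(v)}$ over proper colorings $\kappa:V(G)\to\{1,2,\dots\}$; $G$ is $e$-positive if $X_G$ is a nonnegative linear combination of elementary symmetric functions $e_\lambda$. *)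

theory Defs
  imports "HOL-Library.FuncSet" Complex_Main
begin

(* Simple graphs: finite vertex set V with a symmetric irreflexive adjacency relation E. *)

definition proper_colouring :: "'v set \<Rightarrow> ('v \<Rightarrow> 'v \<Rightarrow> bool) \<Rightarrow> ('v \<Rightarrow> nat) \<Rightarrow> bool" where
  "proper_colouring V E \<kappa> \<longleftrightarrow> (\<forall>u\<in>V. \<forall>v\<in>V. E u v \<longrightarrow> \<kappa> u \<noteq> \<kappa> v)"

(* Coefficient of the monomial prod_j x_j^(alpha j) in the chromatic symmetric function X_G:
   the number of proper colourings in which colour j is used exactly alpha j times.
   (Colours are indexed by nat instead of {1,2,...}; this is a mere relabelling.) *)
definition csf_coeff :: "'v set \<Rightarrow> ('v \<Rightarrow> 'v \<Rightarrow> bool) \<Rightarrow> (nat \<Rightarrow> nat) \<Rightarrow> nat" where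
  "csf_coeff V E \<alpha> = card {\<kappa> \<in> V \<rightarrow>\<^sub>E (UNIV :: nat set).
      proper_colouring V E \<kappa> \<and> (\<forall>j. card {v\<in>V. \<kappa> v = j} = \<alpha> j)}"

(* Coefficient of the monomial prod_j x_j^(alpha j) in e_lam = e_{lam_1} * ... * e_{lam_l}:
   each factor e_{lam_i} contributes a lam_i-element set S_i of distinct variables,
   and colour j must be used in exactly alpha j of the sets. *)
definition e_coeff :: "nat list \<Rightarrow> (nat \<Rightarrow> nat) \<Rightarrow> nat" where
  "e_coeff lam \<alpha> = card {Ss :: nat set list. length Ss = length lam \<and>
      (\<forall>i<length lam. finite (Ss ! i) \<and> card (Ss ! i) = lam ! i) \<and>
      (\<forall>j. card {i. i < length lam \<and> j \<in> Ss ! i} = \<alpha> j)}"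

definition partitions :: "nat \<Rightarrow> nat list set" where
  "partitions n = {lam. sorted_wrt (\<ge>) lam \<and> (\<forall>x\<in>set lam. 0 < x) \<and> sum_list lam = n}"

(* e-positivity: X_G is a nonnegative linear combination of the e_lam (lam a partition of |V|,
   the degree of the homogeneous X_G), compared coefficientwise on all monomials. *)
definition e_positive :: "'v set \<Rightarrow> ('v \<Rightarrow> 'v \<Rightarrow> bool) \<Rightarrow> bool" where
  "e_positive V E \<longleftrightarrow> (\<exists>c :: nat list \<Rightarrow> real.
      (\<forall>lam\<in>partitions (card V). 0 \<le> c lam) \<and>
      (\<forall>\<alpha>. real (csf_coeff V E \<alpha>) = (\<Sum>lam\<in>partitions (card V). c lam * real (e_coeff lam \<alpha>))))"

(* Spider S(lam_1,...,lam_d): centre (0,0); leg i (1 <= i <= d) has vertices (i,1),...,(i,lam_i),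
   with (i,1) adjacent to the centre and (i,j) adjacent to (i,j+1). *)
definition spider_V :: "nat list \<Rightarrow> (nat \<times> nat) set" where
  "spider_V lam = {(0,0)} \<union> {(i,j). 1 \<le> i \<and> i \<le> length lam \<and> 1 \<le> j \<and> j \<le> lam ! (i - 1)}"

definition spider_E :: "nat list \<Rightarrow> nat \<times> nat \<Rightarrow> nat \<times> nat \<Rightarrow> bool" where
  "spider_E lam u v \<longleftrightarrow> u \<in> spider_V lam \<and> v \<in> spider_V lam \<and>
     ((u = (0,0) \<and> fst v \<ge> 1 \<and> snd v = 1) \<or>
      (v = (0,0) \<and> fst u \<ge> 1 \<and> snd u = 1) \<or>
      (fst u = fst v \<and> fst u \<ge> 1 \<and> (snd v = snd u + 1 \<or> snd u = snd v + 1)))"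

end

theory Submission
  imports Defs "HOL-Library.Nat_Bijection"
begin

text \<open>
  By Wolfgang's theorem an \<open>e\<close>-positive tree with \<open>n\<close> vertices can be cut into connected pieces of any
  prescribed sizes with sum \<open>n\<close>. For a type \<open>\<mu>\<close> we see this by substituting, for each part \<open>\<mu>\<^sub>i\<close>, the
  \<open>\<mu>\<^sub>i\<close>-th roots of unity times \<open>u\<^sub>i\<close> for the variables and extracting the terms
  of degree \<open>\<mu>\<^sub>i\<close> in each \<open>u\<^sub>i\<close>.

  Let \<open>\<lambda>\<^sub>1 \<ge> \<dots> \<ge> \<lambda>\<^sub>d\<close> be the legs of a spider. If all parts exceed \<open>\<lambda>\<^sub>j\<close>, the piece containing the
  centre contains the legs \<open>j, \<dots>, d\<close>, so its size exceeds \<open>\<lambda>\<^sub>j + \<dots> + \<lambda>\<^sub>d\<close>. Hence \<open>n\<close> is not a sum of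
  numbers from the interval between \<open>\<lambda>\<^sub>j + 1\<close> and \<open>\<lambda>\<^sub>j + \<lambda>\<^bsub>j+1\<^esub> + 1\<close>, which forces
  \<open>\<lambda>\<^sub>j\<^sup>2 \<ge> (n/2) \<lambda>\<^bsub>j+1\<^esub>\<close> for \<open>j + 2 \<le> d\<close>. Starting from \<open>\<lambda>\<^bsub>d-1\<^esub> \<ge> 1\<close>, this gives
  \<open>\<lambda>\<^bsub>d-1-k\<^esub> / (n/2) \<ge> (n/2)\<close> raised to \<open>-1/2\<^sup>k\<close>. Cutting the spider into two halves shows
  that the legs other than the longest one have total length less than \<open>n/2\<close>; summing gives the claim.
\<close>

section \<open>Cyclic symmetries and weighted colourings of trees\<close>

text \<open>An injective self-map of a finite set permutes it, so reindexing along
  \<open>\<phi>\<close> multiplies the sum by \<open>\<omega>\<close>. The cancellations of power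
  sums, colourings and tuples below all have this form.\<close>

lemma sum_eq_0_if_twisted:
  fixes g :: "'a \<Rightarrow> complex"
  assumes "finite X" "\<phi> ` X \<subseteq> X" "inj_on \<phi> X"
    and "\<And>x. x \<in> X \<Longrightarrow> g (\<phi> x) = \<omega> * g x" and "\<omega> \<noteq> 1"
  shows "sum g X = 0"
proof -
  have "sum g X = sum g (\<phi> ` X)"
    using assms(1-3) endo_inj_surj by metis
  also have "\<dots> = \<omega> * sum g X"
    using assms(3,4) by (simp add: sum.reindex sum_distrib_left)
  finally show ?thesis
    using assms(5) by simp
qed

lemma cis_root_power_neq_1:
  assumes "0 < k" "k < m"
  shows "cis (2 * pi / real m) ^ k \<noteq> 1"
proof
  assume "cis (2 * pi / real m) ^ k = 1"
  then have "cis (real k * (2 * pi / real m)) = 1"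
    by (simp add: DeMoivre)
  then have "cos (real k * (2 * pi / real m)) = 1"
    by (metis cis.sel(1) one_complex.sel(1))
  then obtain x :: int where x: "real k * (2 * pi / real m) = of_int x * 2 * pi"
    using cos_one_2pi_int by auto
  then have "real k = of_int x * real m"
    using assms by (simp add: field_simps)
  then have "int k = x * int m"
    by (metis of_int_eq_iff of_int_mult of_int_of_nat_eq)
  then have "int m dvd int k" by simp
  with assms show False
    by (simp add: nat_dvd_not_less)
qed

lemma sum_leaf_colour:
  fixes z :: "'c \<Rightarrow> complex"
  assumes "finite C" "(\<Sum>c\<in>C. z c ^ k) = 0" "b \<in> C"
  shows "(\<Sum>c\<in>C - {b}. z c ^ k) = - (z b ^ k)"
  using assms by (simp add: sum_diff1)

text \<open>Summing out the colour of a leaf of weight \<open>w\<close> moves that weight, up to a sign, to its parent.\<close>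
lemma sum_tree_colourings:
  fixes z :: "'c \<Rightarrow> complex" and depth :: "'v \<Rightarrow> nat"
  assumes "finite V" "r \<in> V"
    and "\<And>v. v \<in> V \<Longrightarrow> v \<noteq> r \<Longrightarrow> par v \<in> V \<and> depth (par v) < depth v"
    and "\<And>v. v \<in> V \<Longrightarrow> 0 < w v" "sum w V = m"
    and C: "finite C" "\<And>c. c \<in> C \<Longrightarrow> z c ^ m = 1"
      "\<And>k. 0 < k \<Longrightarrow> k < m \<Longrightarrow> (\<Sum>c\<in>C. z c ^ k) = 0"
  shows "(\<Sum>\<kappa> | \<kappa> \<in> V \<rightarrow>\<^sub>E C \<and> (\<forall>v\<in>V - {r}. \<kappa> v \<noteq> \<kappa> (par v)). \<Prod>v\<in>V. z (\<kappa> v) ^ w v)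
    = (- 1) ^ (card V - 1) * of_nat (card C)"
  using assms(1-5)
proof (induction "card V" arbitrary: V w)
  case 0
  then show ?case by auto
next
  case (Suc N)
  show ?case
  proof (cases "V = {r}")
    case True
    \<comment> \<open>At the end the root carries the whole weight \<open>m\<close>, and every
      \<open>z c ^ m\<close> is 1.\<close>
    have "(\<Sum>\<kappa>\<in>{r} \<rightarrow>\<^sub>E C. \<Prod>v\<in>{r}. z (\<kappa> v) ^ w v) = (\<Sum>\<kappa>\<in>{r} \<rightarrow>\<^sub>E C. 1)"
      using Suc.prems(5) True C(2) by (intro sum.cong) (auto simp: PiE_iff)
    also have "\<dots> = of_nat (card C)"
      by (simp add: card_PiE)
    finally show ?thesis
      using True by simp
  next
    case False
    \<comment> \<open>A vertex of maximal depth other than the root is nobody's parent, hence a leaf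
      that can be removed.\<close>
    define D where "D = depth ` (V - {r})"
    have "finite D" "D \<noteq> {}"
      using False Suc.prems(1,2) by (auto simp: D_def)
    then have "Max D \<in> D" by simp
    then obtain v where "Max D = depth v" "v \<in> V - {r}"
      unfolding D_def by (rule imageE)
    then have v: "v \<in> V" "v \<noteq> r" "depth v = Max D" by auto
    have leaf: "par u \<noteq> v" if "u \<in> V" "u \<noteq> r" for u
    proof
      assume "par u = v"
      with Suc.prems(3)[OF that] v have "Max D < depth u" by simp
      moreover have "depth u \<le> Max D"
        using that \<open>finite D\<close> by (simp add: D_def)
      ultimately show False by simp
    qed
    let ?p = "par v"
    have p: "?p \<in> V" "?p \<noteq> v"
      using Suc.prems(3)[of v] v leaf by auto
    define V' where "V' = V - {v}"
    define w' where "w' = w(?p := w ?p + w v)"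
    have V': "V = insert v V'" "v \<notin> V'" "finite V'" "r \<in> V'" "?p \<in> V'"
      using v p Suc.prems(1,2) by (auto simp: V'_def)
    have w'_sum: "sum w' V' = m"
    proof -
      have "sum w' V' = w' ?p + sum w' (V' - {?p})"
        using V' by (intro sum.remove) auto
      also have "sum w' (V' - {?p}) = sum w (V' - {?p})"
        by (intro sum.cong) (auto simp: w'_def)
      also have "w' ?p + \<dots> = w v + (w ?p + sum w (V' - {?p}))"
        by (simp add: w'_def)
      also have "w ?p + sum w (V' - {?p}) = sum w V'"
        using V' by (intro sum.remove[symmetric]) auto
      also have "w v + \<dots> = m"
        using V' Suc.prems(5) by simp
      finally show ?thesis .
    qed
    define K where "K = {\<kappa> \<in> V' \<rightarrow>\<^sub>E C. \<forall>u\<in>V' - {r}. \<kappa> u \<noteq> \<kappa> (par u)}"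
    have cardV: "card V = Suc (card V')"
      using V' by simp
    have IH: "(\<Sum>\<kappa>\<in>K. \<Prod>u\<in>V'. z (\<kappa> u) ^ w' u) = (- 1) ^ (card V' - 1) * of_nat (card C)"
      unfolding K_def
    proof (rule Suc.hyps(1))
      show "N = card V'" using Suc.hyps(2) cardV by simp
      show "par u \<in> V' \<and> depth (par u) < depth u" if "u \<in> V'" "u \<noteq> r" for u
        using that Suc.prems(3)[of u] leaf[of u] by (auto simp: V'_def)
      show "0 < w' u" if "u \<in> V'" for u
        using that Suc.prems(4) by (auto simp: w'_def V'_def)
    qed (use V' w'_sum in auto)
    \<comment> \<open>The parent also has positive weight, so the leaf weight stays below
      \<open>m\<close>, in the range where the power sums over \<open>C\<close> vanish.\<close>
    have wv: "0 < w v" "w v < m"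
    proof -
      show "0 < w v" using Suc.prems(4) v by simp
      have "0 < w ?p" using Suc.prems(4) p by simp
      moreover have "w ?p \<le> sum w V'"
        using V' by (simp add: member_le_sum)
      moreover have "w v + sum w V' = m"
        using V' Suc.prems(5) by simp
      ultimately show "w v < m" by simp
    qed
    define ext where "ext = (\<lambda>(\<kappa>, c). \<kappa>(v := c) :: 'v \<Rightarrow> 'c)"
    define restr where "restr = (\<lambda>\<kappa> :: 'v \<Rightarrow> 'c. (\<kappa>(v := undefined), \<kappa> v))"
    have bij: "bij_betw ext (SIGMA \<kappa>:K. C - {\<kappa> ?p})
        {\<kappa> \<in> V \<rightarrow>\<^sub>E C. \<forall>u\<in>V - {r}. \<kappa> u \<noteq> \<kappa> (par u)}"
    proof (rule bij_betwI[where g = restr])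
      show "ext \<in> (SIGMA \<kappa>:K. C - {\<kappa> ?p})
          \<rightarrow> {\<kappa> \<in> V \<rightarrow>\<^sub>E C. \<forall>u\<in>V - {r}. \<kappa> u \<noteq> \<kappa> (par u)}"
        using leaf V' v p by (fastforce simp: ext_def K_def PiE_iff extensional_def split: if_splits)
      show "restr
          \<in> {\<kappa> \<in> V \<rightarrow>\<^sub>E C. \<forall>u\<in>V - {r}. \<kappa> u \<noteq> \<kappa> (par u)} \<rightarrow> (SIGMA \<kappa>:K. C - {\<kappa> ?p})"
        using leaf V' v p by (auto simp: restr_def K_def PiE_iff extensional_def split: if_splits)
      show "restr (ext x) = x" if "x \<in> (SIGMA \<kappa>:K. C - {\<kappa> ?p})" for x
        using that V' by (auto simp: ext_def restr_def K_def PiE_iff extensional_def fun_eq_iff)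
      show "ext (restr \<kappa>) = \<kappa>"
        if "\<kappa> \<in> {\<kappa> \<in> V \<rightarrow>\<^sub>E C. \<forall>u\<in>V - {r}. \<kappa> u \<noteq> \<kappa> (par u)}" for \<kappa>
        by (auto simp: ext_def restr_def)
    qed
    have finK: "finite K"
      unfolding K_def by (rule finite_subset[OF _ finite_PiE[of V' "\<lambda>_. C"]]) (use V' C in auto)
    have "(\<Sum>\<kappa> | \<kappa> \<in> V \<rightarrow>\<^sub>E C \<and> (\<forall>u\<in>V - {r}. \<kappa> u \<noteq> \<kappa> (par u)). \<Prod>u\<in>V. z (\<kappa> u) ^ w u)
        = (\<Sum>(\<kappa>, c)\<in>(SIGMA \<kappa>:K. C - {\<kappa> ?p}). \<Prod>u\<in>V. z ((\<kappa>(v := c)) u) ^ w u)"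
      using sum.reindex_bij_betw[OF bij, of "\<lambda>\<kappa>. \<Prod>u\<in>V. z (\<kappa> u) ^ w u"]
      by (simp add: ext_def case_prod_unfold)
    also have "\<dots> = (\<Sum>(\<kappa>, c)\<in>(SIGMA \<kappa>:K. C - {\<kappa> ?p}). z c ^ w v * (\<Prod>u\<in>V'. z (\<kappa> u) ^ w u))"
    proof -
      have "(\<Prod>u\<in>V'. z ((\<kappa>(v := c)) u) ^ w u) = (\<Prod>u\<in>V'. z (\<kappa> u) ^ w u)" for \<kappa> c
        using V' by (intro prod.cong) auto
      then have "(\<Prod>u\<in>V. z ((\<kappa>(v := c)) u) ^ w u) = z c ^ w v * (\<Prod>u\<in>V'. z (\<kappa> u) ^ w u)" for \<kappa> c
        using V' by simp
      then show ?thesis by (simp only:)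
    qed
    also have "\<dots> = (\<Sum>\<kappa>\<in>K. (\<Sum>c\<in>C - {\<kappa> ?p}. z c ^ w v) * (\<Prod>u\<in>V'. z (\<kappa> u) ^ w u))"
      using finK C by (simp add: sum.Sigma[symmetric] sum_distrib_right)
    also have "\<dots> = (\<Sum>\<kappa>\<in>K. - (\<Prod>u\<in>V'. z (\<kappa> u) ^ w' u))"
    proof (rule sum.cong[OF refl])
      fix \<kappa> assume \<kappa>: "\<kappa> \<in> K"
      then have "\<kappa> ?p \<in> C" using V' by (auto simp: K_def)
      then have 1: "(\<Sum>c\<in>C - {\<kappa> ?p}. z c ^ w v) = - (z (\<kappa> ?p) ^ w v)"
        using C wv by (intro sum_leaf_colour) auto
      have "(\<Prod>u\<in>V'. z (\<kappa> u) ^ w' u) = z (\<kappa> ?p) ^ w' ?p * (\<Prod>u\<in>V' - {?p}. z (\<kappa> u) ^ w' u)"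
        using V' by (intro prod.remove) auto
      also have "(\<Prod>u\<in>V' - {?p}. z (\<kappa> u) ^ w' u) = (\<Prod>u\<in>V' - {?p}. z (\<kappa> u) ^ w u)"
        by (intro prod.cong) (auto simp: w'_def)
      also have "z (\<kappa> ?p) ^ w' ?p * \<dots> = z (\<kappa> ?p) ^ w v * (\<Prod>u\<in>V'. z (\<kappa> u) ^ w u)"
        using V' by (simp add: w'_def power_add prod.remove[of V' ?p])
      finally show "(\<Sum>c\<in>C - {\<kappa> ?p}. z c ^ w v) * (\<Prod>u\<in>V'. z (\<kappa> u) ^ w u)
          = - (\<Prod>u\<in>V'. z (\<kappa> u) ^ w' u)"
        using 1 by simp
    qed
    also have "\<dots> = - ((- 1) ^ (card V' - 1) * of_nat (card C))"
      using IH by (simp add: sum_negf)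
    also have "\<dots> = (- 1) ^ (card V - 1) * of_nat (card C)"
    proof -
      have "card V' \<noteq> 0" using V' by auto
      then show ?thesis unfolding cardV by (cases "card V'") auto
    qed
    finally show ?thesis .
  qed
qed

section \<open>Sums of parts from an interval\<close>

text \<open>Greedy choice: each entry takes as much of the remaining sum as the bound
  \<open>p\<close> permits.\<close>

lemma bounded_list_with_sum:
  assumes "(r::nat) \<le> J * p"
  shows "\<exists>es. length es = J \<and> (\<forall>e\<in>set es. e \<le> p) \<and> sum_list es = r"
  using assms
proof (induction J arbitrary: r)
  case 0
  then show ?case by simp
next
  case (Suc J)
  have "r - min r p \<le> J * p" using Suc.prems by auto
  from Suc.IH[OF this] obtain es where
    "length es = J" "\<forall>e\<in>set es. e \<le> p" "sum_list es = r - min r p" by blast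
  then show ?case by (intro exI[of _ "min r p # es"]) auto
qed

text \<open>Take \<open>n div (a + 1)\<close> parts of size \<open>a + 1\<close> and spread the
  remainder, which is at most \<open>a\<close>, over them with at most \<open>p\<close> added to
  each. The assumption says that this capacity suffices.\<close>

lemma parts_in_interval:
  assumes "(a::nat) \<le> (n div (a + 1)) * p"
  shows "\<exists>mu. (\<forall>x\<in>set mu. a + 1 \<le> x \<and> x \<le> a + 1 + p) \<and> sum_list mu = n"
proof -
  have "n mod (a + 1) \<le> (n div (a + 1)) * p"
    using assms mod_less_divisor[of "a + 1" n] by linarith
  then obtain es where es: "length es = n div (a + 1)" "\<forall>e\<in>set es. e \<le> p"
      "sum_list es = n mod (a + 1)"
    using bounded_list_with_sum by blast
  have "sum_list (map (\<lambda>e. (a + 1) + e) es) = length es * (a + 1) + sum_list es" for es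
    by (induction es) auto
  then have "sum_list (map (\<lambda>e. (a + 1) + e) es) = n"
    using es div_mult_mod_eq[of n "a + 1"] by simp
  then show ?thesis
    using es by (intro exI[of _ "map (\<lambda>e. (a + 1) + e) es"]) auto
qed

section \<open>Colour classes and evaluation at roots of unity\<close>

text \<open>Connectedness of the induced subgraph, phrased through cuts: its failure directly yields
  a part \<open>A\<close> with no edge to the rest, which is the part to be rotated.\<close>

definition linked :: "('v \<Rightarrow> 'v \<Rightarrow> bool) \<Rightarrow> 'v set \<Rightarrow> bool" where
  "linked E B \<longleftrightarrow> (\<forall>A. A \<noteq> {} \<and> A \<subset> B \<longrightarrow> (\<exists>u\<in>A. \<exists>v\<in>B - A. E u v))"

locale composition =
  fixes mu :: "nat list"
  assumes parts_pos: "\<And>m. m \<in> set mu \<Longrightarrow> 0 < m"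
begin

text \<open>A colour is the code of a pair \<open>(i, t)\<close> and stands for the formal variable
  \<open>u_i\<close> times the \<open>t\<close>-th power of a primitive root of unity of order
  \<open>mu ! i\<close>. The value \<open>wt\<close> retains only the root of unity.\<close>

definition cls :: "nat \<Rightarrow> nat" where
  "cls c = fst (prod_decode c)"

definition colours :: "nat set" where
  "colours = prod_encode ` (SIGMA i:{..<length mu}. {..<mu ! i})"

definition wt :: "nat \<Rightarrow> complex" where
  "wt c = cis (2 * pi / real (mu ! cls c)) ^ snd (prod_decode c)"

text \<open>The cyclic shift inside class \<open>i\<close>, which multiplies the values of that
  class by the primitive root.\<close>

definition rot :: "nat \<Rightarrow> nat \<Rightarrow> nat" where
  "rot i c = (if cls c = i then prod_encode (i, (snd (prod_decode c) + 1) mod (mu ! i)) else c)"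

text \<open>Exponent vectors of degree \<open>mu ! i\<close> in each \<open>u_i\<close>. Restricting
  to them extracts the desired coefficient without introducing the variables
  \<open>u_i\<close>.\<close>

definition admissible :: "(nat \<Rightarrow> nat) set" where
  "admissible = {\<alpha>. (\<forall>c. c \<notin> colours \<longrightarrow> \<alpha> c = 0) \<and>
     (\<forall>i<length mu. (\<Sum>c | c \<in> colours \<and> cls c = i. \<alpha> c) = mu ! i)}"

definition weight :: "(nat \<Rightarrow> nat) \<Rightarrow> complex" where
  "weight \<alpha> = (\<Prod>c\<in>colours. wt c ^ \<alpha> c)"

text \<open>Up to a nonzero factor this is the coefficient of \<open>p\<^sub>\<mu>\<close> in the power sum expansion of the
  symmetric function whose monomial coefficients are \<open>f\<close>.\<close>
definition power_sum_functional :: "((nat \<Rightarrow> nat) \<Rightarrow> nat) \<Rightarrow> complex" where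
  "power_sum_functional f = (\<Sum>\<alpha>\<in>admissible. of_nat (f \<alpha>) * weight \<alpha>)"

lemma nth_mu_pos: "i < length mu \<Longrightarrow> 0 < mu ! i"
  using parts_pos by simp

lemma finite_colours [simp]: "finite colours"
  by (simp add: colours_def)

lemma mem_colours: "c \<in> colours \<longleftrightarrow> cls c < length mu \<and> snd (prod_decode c) < mu ! cls c"
proof
  show "c \<in> colours \<Longrightarrow> cls c < length mu \<and> snd (prod_decode c) < mu ! cls c"
    by (auto simp: colours_def cls_def)
  assume "cls c < length mu \<and> snd (prod_decode c) < mu ! cls c"
  then have "prod_encode (prod_decode c) \<in> colours"
    unfolding colours_def cls_def by (intro imageI) (auto simp: mem_Times_iff Sigma_def prod_eq_iff)
  then show "c \<in> colours" by simp
qed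

lemma card_class:
  assumes "i < length mu"
  shows "card {c \<in> colours. cls c = i} = mu ! i"
proof -
  have "{c \<in> colours. cls c = i} = (\<lambda>t. prod_encode (i, t)) ` {..<mu ! i}"
    using assms by (auto simp: colours_def cls_def)
  also have "card \<dots> = mu ! i"
    by (subst card_image) (auto simp: inj_on_def)
  finally show ?thesis .
qed

lemma card_colours: "card colours = sum_list mu"
proof -
  have "card colours = (\<Sum>i<length mu. mu ! i)"
    unfolding colours_def by (subst card_image) (auto simp: inj_prod_encode)
  then show ?thesis
    by (simp add: sum_list_sum_nth atLeast0LessThan)
qed

lemma cls_rot [simp]: "cls (rot i c) = cls c"
  by (simp add: rot_def cls_def)

lemma rot_in_colours: "c \<in> colours \<Longrightarrow> rot i c \<in> colours"
  using nth_mu_pos by (auto simp: mem_colours rot_def cls_def)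

lemma inj_on_rot: "inj_on (rot i) colours"
proof (rule inj_onI)
  fix c d
  assume c: "c \<in> colours" and d: "d \<in> colours" and eq: "rot i c = rot i d"
  then have cls: "cls c = cls d" by (metis cls_rot)
  show "c = d"
  proof (cases "cls c = i")
    case False
    then show ?thesis using eq cls by (simp add: rot_def)
  next
    case True
    let ?t = "\<lambda>c. snd (prod_decode c)"
    have "(?t c + 1) mod (mu ! i) = (?t d + 1) mod (mu ! i)"
      using eq True cls by (simp add: rot_def)
    moreover have "?t c < mu ! i" "?t d < mu ! i"
      using c d True cls by (auto simp: mem_colours)
    ultimately have "?t c = ?t d"
      by (auto simp: mod_Suc split: if_splits)
    then show ?thesis
      using cls by (metis cls_def prod.expand prod_decode_inverse)
  qed
qed

lemma wt_rot:
  assumes "c \<in> colours"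
  shows "wt (rot i c) = (if cls c = i then cis (2 * pi / real (mu ! i)) else 1) * wt c"
proof (cases "cls c = i")
  case False
  then show ?thesis by (simp add: rot_def)
next
  case True
  let ?z = "cis (2 * pi / real (mu ! i))" and ?t = "snd (prod_decode c)"
  have "0 < mu ! i"
    using assms True by (auto simp: mem_colours)
  then have "?z ^ (mu ! i) = 1"
    by (simp add: DeMoivre)
  then have "?z ^ ((?t + 1) mod (mu ! i)) = ?z ^ (?t + 1)"
    by (metis mult_1 power_add power_mult power_one div_mult_mod_eq mult.commute)
  moreover have "wt (rot i c) = ?z ^ ((?t + 1) mod (mu ! i))"
    using True by (simp add: wt_def) (simp add: rot_def)
  ultimately show ?thesis
    using True by (simp add: wt_def)
qed

lemma prod_wt_rot:
  assumes "S \<subseteq> colours"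
  shows "(\<Prod>c\<in>S. wt (rot i c)) =
    cis (2 * pi / real (mu ! i)) ^ card {c \<in> S. cls c = i} * (\<Prod>c\<in>S. wt c)"
proof -
  have "finite S" using assms finite_subset finite_colours by blast
  have "(\<Prod>c\<in>S. wt (rot i c)) =
      (\<Prod>c\<in>S. (if cls c = i then cis (2 * pi / real (mu ! i)) else 1) * wt c)"
    using assms by (intro prod.cong) (auto simp: wt_rot)
  then show ?thesis
    using \<open>finite S\<close> by (simp add: prod.distrib prod.If_cases Int_def)
qed

lemma finite_admissible: "finite admissible"
proof (rule finite_subset)
  show "finite {\<alpha>. \<forall>c. (c \<in> colours \<longrightarrow> \<alpha> c \<in> {..sum_list mu}) \<and> (c \<notin> colours \<longrightarrow> \<alpha> c = 0)}"
    by (rule finite_set_of_finite_funs) auto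
  show "admissible \<subseteq> {\<alpha>. \<forall>c. (c \<in> colours \<longrightarrow> \<alpha> c \<in> {..sum_list mu}) \<and> (c \<notin> colours \<longrightarrow> \<alpha> c = 0)}"
  proof (clarsimp simp: admissible_def)
    fix \<alpha> c
    assume \<alpha>: "\<forall>i<length mu. (\<Sum>c | c \<in> colours \<and> cls c = i. \<alpha> c) = mu ! i" and c: "c \<in> colours"
    have "\<alpha> c \<le> (\<Sum>c' | c' \<in> colours \<and> cls c' = cls c. \<alpha> c')"
      using c by (intro member_le_sum) auto
    also have "\<dots> \<le> sum_list mu"
      using \<alpha> c by (simp add: mem_colours elem_le_sum_list)
    finally show "\<alpha> c \<le> sum_list mu" .
  qed
qed

text \<open>Monomial coefficients that count objects by content turn the functional into a sum over
  the objects themselves. It is applied to proper colourings and to the tuples of sets counted by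
  \<open>e_coeff\<close>.\<close>

lemma power_sum_functional_card:
  assumes "\<And>\<alpha>. f \<alpha> = card {x \<in> X. cont x = \<alpha>}" and "finite {x \<in> X. cont x \<in> admissible}"
  shows "power_sum_functional f = (\<Sum>x | x \<in> X \<and> cont x \<in> admissible. weight (cont x))"
proof -
  let ?Y = "{x \<in> X. cont x \<in> admissible}"
  have "(\<Sum>x\<in>?Y. weight (cont x)) = (\<Sum>\<alpha>\<in>admissible. \<Sum>x | x \<in> ?Y \<and> cont x = \<alpha>. weight (cont x))"
    by (rule sum.group[symmetric]) (use assms finite_admissible in auto)
  also have "\<dots> = (\<Sum>\<alpha>\<in>admissible. \<Sum>x | x \<in> X \<and> cont x = \<alpha>. weight \<alpha>)"
    by (intro sum.cong) auto
  also have "\<dots> = power_sum_functional f"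
    by (simp add: power_sum_functional_def assms(1))
  finally show ?thesis by simp
qed

section \<open>Chromatic symmetric functions and connected partitions\<close>

definition class_colourings :: "'v set \<Rightarrow> ('v \<Rightarrow> 'v \<Rightarrow> bool) \<Rightarrow> ('v \<Rightarrow> nat) set" where
  "class_colourings V E = {\<kappa> \<in> V \<rightarrow>\<^sub>E colours. proper_colouring V E \<kappa> \<and>
     (\<forall>i<length mu. card {v \<in> V. cls (\<kappa> v) = i} = mu ! i)}"

lemma finite_class_colourings: "finite V \<Longrightarrow> finite (class_colourings V E)"
  unfolding class_colourings_def by (rule finite_subset[OF _ finite_PiE[of V "\<lambda>_. colours"]]) auto

lemma power_sum_functional_csf:
  assumes "finite V"
  shows "power_sum_functional (csf_coeff V E) = (\<Sum>\<kappa>\<in>class_colourings V E. \<Prod>v\<in>V. wt (\<kappa> v))"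
proof -
  define X where "X = {\<kappa> \<in> V \<rightarrow>\<^sub>E (UNIV :: nat set). proper_colouring V E \<kappa>}"
  define cont where "cont = (\<lambda>\<kappa> (j::nat). card {v \<in> V. \<kappa> v = j})"
  have class_sum: "(\<Sum>c | c \<in> colours \<and> cls c = i. cont \<kappa> c) = card {v \<in> V. cls (\<kappa> v) = i}"
    if "\<forall>v\<in>V. \<kappa> v \<in> colours" for \<kappa> i
  proof -
    have "card {v \<in> V. cls (\<kappa> v) = i}
        = (\<Sum>c\<in>{c \<in> colours. cls c = i}. \<Sum>v | v \<in> {v \<in> V. cls (\<kappa> v) = i} \<and> \<kappa> v = c. 1)"
      using assms that by (subst sum.group) auto
    also have "\<dots> = (\<Sum>c | c \<in> colours \<and> cls c = i. cont \<kappa> c)"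
      unfolding cont_def card_eq_sum by (intro sum.cong) auto
    finally show ?thesis by simp
  qed
  have supp: "(\<forall>c. c \<notin> colours \<longrightarrow> cont \<kappa> c = 0) \<longleftrightarrow> (\<forall>v\<in>V. \<kappa> v \<in> colours)" for \<kappa>
    using assms by (auto simp: cont_def)
  have eq: "{\<kappa> \<in> X. cont \<kappa> \<in> admissible} = class_colourings V E"
    by (auto simp: X_def admissible_def supp class_sum class_colourings_def PiE_iff)
  have "power_sum_functional (csf_coeff V E) = (\<Sum>\<kappa> | \<kappa> \<in> X \<and> cont \<kappa> \<in> admissible. weight (cont \<kappa>))"
  proof (rule power_sum_functional_card)
    show "csf_coeff V E \<alpha> = card {x \<in> X. cont x = \<alpha>}" for \<alpha>
      unfolding csf_coeff_def X_def cont_def fun_eq_iff by (rule arg_cong[where f = card]) auto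
  qed (use eq finite_class_colourings[OF assms] in simp)
  also have "\<dots> = (\<Sum>\<kappa>\<in>class_colourings V E. \<Prod>v\<in>V. wt (\<kappa> v))"
    unfolding eq
  proof (rule sum.cong[OF refl])
    fix \<kappa> assume "\<kappa> \<in> class_colourings V E"
    then have "\<kappa> ` V \<subseteq> colours" by (auto simp: class_colourings_def)
    then have "(\<Prod>v\<in>V. wt (\<kappa> v)) = (\<Prod>c\<in>colours. \<Prod>v | v \<in> V \<and> \<kappa> v = c. wt (\<kappa> v))"
      using assms by (intro prod.group[symmetric]) auto
    also have "\<dots> = (\<Prod>c\<in>colours. \<Prod>v | v \<in> V \<and> \<kappa> v = c. wt c)"
      by (intro prod.cong) auto
    finally show "weight (cont \<kappa>) = (\<Prod>v\<in>V. wt (\<kappa> v))"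
      by (simp add: weight_def cont_def)
  qed
  finally show ?thesis .
qed

text \<open>If some block \<open>f = i\<close> splits into two parts without edges between them, rotating the colours of
  class \<open>i\<close> on one part is a symmetry of the colourings inducing \<open>f\<close> that multiplies their weight by
  a nontrivial root of unity.\<close>
lemma connected_partition_if_functional_nonzero:
  fixes V :: "'v set"
  assumes "finite V" and sym: "\<And>u v. E u v \<Longrightarrow> E v u"
    and "power_sum_functional (csf_coeff V E) \<noteq> 0"
  shows "\<exists>f. (\<forall>v\<in>V. f v < length mu) \<and> (\<forall>i<length mu. card {v \<in> V. f v = i} = mu ! i) \<and>
    (\<forall>i<length mu. linked E {v \<in> V. f v = i})"
proof (rule ccontr)
  assume none: "\<not> ?thesis"
  let ?K = "class_colourings V E" and ?g = "\<lambda>\<kappa>. \<Prod>v\<in>V. wt (\<kappa> v)"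
  \<comment> \<open>Colourings are grouped by the map from vertices to classes that they induce. By
    assumption each such map has a disconnected block, so each group will sum to 0.\<close>
  define pat where "pat = (\<lambda>(\<kappa> :: 'v \<Rightarrow> nat) v. cls (\<kappa> v))"
  have "sum ?g {\<kappa> \<in> ?K. pat \<kappa> = f} = 0" if f: "f \<in> pat ` ?K" for f
  proof -
    obtain \<kappa>0 where \<kappa>0: "\<kappa>0 \<in> ?K" "f = pat \<kappa>0" using f by auto
    have "\<forall>v\<in>V. f v < length mu"
      using \<kappa>0 by (auto simp: class_colourings_def pat_def PiE_iff mem_colours)
    moreover have sizes: "\<forall>i<length mu. card {v \<in> V. f v = i} = mu ! i"
      using \<kappa>0 by (auto simp: class_colourings_def pat_def)
    ultimately obtain i where i: "i < length mu" "\<not> linked E {v \<in> V. f v = i}"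
      using none by blast
    then obtain A where A: "A \<noteq> {}" "A \<subset> {v \<in> V. f v = i}"
      and sep: "\<And>u v. u \<in> A \<Longrightarrow> v \<in> {v \<in> V. f v = i} - A \<Longrightarrow> \<not> E u v"
      unfolding linked_def by metis
    have finA: "finite A" using A(2) assms(1) by (auto intro: finite_subset)
    \<comment> \<open>Since \<open>A\<close> is a nonempty proper part of a block with
      \<open>mu ! i\<close> vertices, the factor picked up by rotating it is not 1.\<close>
    have "card A < mu ! i" "0 < card A"
      using psubset_card_mono[OF _ A(2)] assms(1) sizes i A(1) finA by (auto simp: card_gt_0_iff)
    then have \<omega>: "cis (2 * pi / real (mu ! i)) ^ card A \<noteq> 1"
      by (intro cis_root_power_neq_1)
    define \<phi> where "\<phi> = (\<lambda>\<kappa> v. if v \<in> A then rot i (\<kappa> v) else \<kappa> v)"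
    have pat\<phi>: "pat (\<phi> \<kappa>) = pat \<kappa>" for \<kappa>
      by (auto simp: pat_def \<phi>_def)
    show ?thesis
    proof (rule sum_eq_0_if_twisted[OF _ _ _ _ \<omega>])
      show "finite {\<kappa> \<in> ?K. pat \<kappa> = f}"
        using finite_class_colourings[OF assms(1)] by simp
      show "\<phi> ` {\<kappa> \<in> ?K. pat \<kappa> = f} \<subseteq> {\<kappa> \<in> ?K. pat \<kappa> = f}"
      proof clarify
        fix \<kappa> assume \<kappa>: "\<kappa> \<in> ?K" "f = pat \<kappa>"
        have "\<phi> \<kappa> \<in> V \<rightarrow>\<^sub>E colours"
          using \<kappa> A by (auto simp: class_colourings_def \<phi>_def PiE_iff extensional_def rot_in_colours)
        moreover have "proper_colouring V E (\<phi> \<kappa>)"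
          unfolding proper_colouring_def
        proof (intro ballI impI)
          fix u v assume uv: "u \<in> V" "v \<in> V" "E u v"
          then have ne: "\<kappa> u \<noteq> \<kappa> v"
            using \<kappa> by (auto simp: class_colourings_def proper_colouring_def)
          have col: "\<kappa> u \<in> colours" "\<kappa> v \<in> colours"
            using \<kappa> uv by (auto simp: class_colourings_def)
          show "\<phi> \<kappa> u \<noteq> \<phi> \<kappa> v"
          \<comment> \<open>Rotation keeps classes, so vertices of different blocks keep different
            colours. Adjacent vertices of block \<open>i\<close> are rotated together or not at all,
            and \<open>rot i\<close> is injective.\<close>
          proof (cases "f u = f v")
            case False
            then show ?thesis
              using \<kappa>(2) pat\<phi>[of \<kappa>] by (metis pat_def)
          next
            case True
            show ?thesis
            proof (cases "f u = i")
              case True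
              with \<open>f u = f v\<close> uv have "u \<in> A \<longleftrightarrow> v \<in> A"
                using sep[of u v] sep[of v u] sym by auto
              then show ?thesis
                using ne col inj_on_rot[of i] by (auto simp: \<phi>_def inj_on_def)
            next
              case False
              with True have "u \<notin> A" "v \<notin> A" using A by auto
              then show ?thesis using ne by (simp add: \<phi>_def)
            qed
          qed
        qed
        moreover have "\<forall>i<length mu. card {v \<in> V. cls (\<phi> \<kappa> v) = i} = mu ! i"
          using \<kappa> pat\<phi>[of \<kappa>] by (auto simp: class_colourings_def pat_def fun_eq_iff)
        ultimately show "\<phi> \<kappa> \<in> ?K \<and> pat (\<phi> \<kappa>) = pat \<kappa>"
          using pat\<phi> by (auto simp: class_colourings_def)
      qed
      show "inj_on \<phi> {\<kappa> \<in> ?K. pat \<kappa> = f}"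
      proof (rule inj_onI)
        fix \<kappa> \<kappa>' assume \<kappa>: "\<kappa> \<in> {\<kappa> \<in> ?K. pat \<kappa> = f}" "\<kappa>' \<in> {\<kappa> \<in> ?K. pat \<kappa> = f}"
          and eq: "\<phi> \<kappa> = \<phi> \<kappa>'"
        show "\<kappa> = \<kappa>'"
        proof
          fix v
          show "\<kappa> v = \<kappa>' v"
          proof (cases "v \<in> A")
            case True
            then have "rot i (\<kappa> v) = rot i (\<kappa>' v)"
              using fun_cong[OF eq, of v] by (simp add: \<phi>_def)
            moreover have "\<kappa> v \<in> colours" "\<kappa>' v \<in> colours"
              using \<kappa> True A by (auto simp: class_colourings_def)
            ultimately show ?thesis using inj_on_rot by (auto dest: inj_onD)
          next
            case False
            then show ?thesis using fun_cong[OF eq, of v] by (simp add: \<phi>_def)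
          qed
        qed
      qed
      show "?g (\<phi> \<kappa>) = cis (2 * pi / real (mu ! i)) ^ card A * ?g \<kappa>"
        if \<kappa>: "\<kappa> \<in> {\<kappa> \<in> ?K. pat \<kappa> = f}" for \<kappa>
      proof -
        have "?g (\<phi> \<kappa>) = (\<Prod>v\<in>V. (if v \<in> A then cis (2 * pi / real (mu ! i)) else 1) * wt (\<kappa> v))"
        proof (rule prod.cong[OF refl])
          fix v assume "v \<in> V"
          then have "\<kappa> v \<in> colours" using \<kappa> by (auto simp: class_colourings_def)
          moreover have "cls (\<kappa> v) = i" if "v \<in> A" using that \<kappa> A by (auto simp: pat_def)
          ultimately show "wt (\<phi> \<kappa> v)
              = (if v \<in> A then cis (2 * pi / real (mu ! i)) else 1) * wt (\<kappa> v)"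
            by (auto simp: \<phi>_def wt_rot)
        qed
        also have "\<dots> = cis (2 * pi / real (mu ! i)) ^ card (V \<inter> A) * ?g \<kappa>"
          using assms(1) by (simp add: prod.distrib prod.If_cases)
        also have "V \<inter> A = A" using A by auto
        finally show ?thesis .
      qed
    qed
  qed
  then have "sum ?g ?K = 0"
    by (subst sum.image_gen[OF finite_class_colourings[OF assms(1)], of _ _ pat]) simp
  then show False
    using assms(1,3) power_sum_functional_csf by metis
qed

section \<open>Elementary symmetric functions at roots of unity\<close>

definition class_tuples :: "nat list \<Rightarrow> nat set list set" where
  "class_tuples la = {Ss. length Ss = length la \<and>
     (\<forall>j<length la. Ss ! j \<subseteq> colours \<and> card (Ss ! j) = la ! j) \<and>
     (\<forall>i<length mu. (\<Sum>j<length la. card {c \<in> Ss ! j. cls c = i}) = mu ! i)}"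

text \<open>Each class is either contained in a given set or disjoint from it. Such a tuple amounts
  to grouping the parts of \<open>mu\<close> into blocks with sums \<open>la ! j\<close>, the
  objects that count the power sum coefficient of \<open>e_la\<close> up to a common factor.\<close>

definition block_tuples :: "nat list \<Rightarrow> nat set list set" where
  "block_tuples la = {Ss \<in> class_tuples la.
     \<forall>j<length la. \<forall>i<length mu. card {c \<in> Ss ! j. cls c = i} \<in> {0, mu ! i}}"

lemma finite_class_tuples: "finite (class_tuples la)"
proof (rule finite_subset)
  show "class_tuples la \<subseteq> {Ss. set Ss \<subseteq> Pow colours \<and> length Ss = length la}"
    by (auto simp: class_tuples_def in_set_conv_nth) blast
  show "finite {Ss. set Ss \<subseteq> Pow colours \<and> length Ss = length la}"
    by (rule finite_lists_length_eq) simp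
qed

lemma power_sum_functional_e_sum:
  "power_sum_functional (e_coeff la)
    = (\<Sum>Ss\<in>class_tuples la. \<Prod>c\<in>colours. wt c ^ card {j. j < length la \<and> c \<in> Ss ! j})"
proof -
  define X where "X = {Ss :: nat set list. length Ss = length la \<and>
      (\<forall>i<length la. finite (Ss ! i) \<and> card (Ss ! i) = la ! i)}"
  define cont where "cont = (\<lambda>(Ss :: nat set list) c. card {j. j < length la \<and> c \<in> Ss ! j})"
  have class_sum: "(\<Sum>c | c \<in> colours \<and> cls c = i. cont Ss c)
      = (\<Sum>j<length la. card {c \<in> Ss ! j. cls c = i})"
    if "\<forall>j<length la. Ss ! j \<subseteq> colours" for Ss i
  proof -
    have "(\<Sum>c | c \<in> colours \<and> cls c = i. cont Ss c)
        = (\<Sum>c | c \<in> colours \<and> cls c = i. \<Sum>j | j \<in> {..<length la} \<and> c \<in> Ss ! j. 1)"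
      by (simp add: cont_def)
    also have "\<dots> = (\<Sum>j<length la. \<Sum>c | c \<in> {c \<in> colours. cls c = i} \<and> c \<in> Ss ! j. 1)"
      by (rule sum.swap_restrict) auto
    also have "\<dots> = (\<Sum>j<length la. card {c \<in> Ss ! j. cls c = i})"
    proof (intro sum.cong refl)
      fix j assume "j \<in> {..<length la}"
      then have "{c. c \<in> {c \<in> colours. cls c = i} \<and> c \<in> Ss ! j} = {c \<in> Ss ! j. cls c = i}"
        using that by auto
      then show "(\<Sum>c | c \<in> {c \<in> colours. cls c = i} \<and> c \<in> Ss ! j. 1) = card {c \<in> Ss ! j. cls c = i}"
        by simp
    qed
    finally show ?thesis .
  qed
  have supp: "(\<forall>c. c \<notin> colours \<longrightarrow> cont Ss c = 0) \<longleftrightarrow> (\<forall>j<length la. Ss ! j \<subseteq> colours)" for Ss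
    by (auto simp: cont_def)
  have eq: "{Ss \<in> X. cont Ss \<in> admissible} = class_tuples la"
  proof (rule set_eqI)
    fix Ss
    show "Ss \<in> {Ss \<in> X. cont Ss \<in> admissible} \<longleftrightarrow> Ss \<in> class_tuples la"
    proof (cases "\<forall>j<length la. Ss ! j \<subseteq> colours")
      case True
      then have "\<forall>j<length la. finite (Ss ! j)"
        using finite_subset[OF _ finite_colours] by blast
      with True show ?thesis
        by (simp add: X_def admissible_def supp class_sum[OF True] class_tuples_def)
    next
      case False
      then show ?thesis
        by (simp add: X_def admissible_def supp class_tuples_def) blast
    qed
  qed
  have "power_sum_functional (e_coeff la) = (\<Sum>Ss | Ss \<in> X \<and> cont Ss \<in> admissible. weight (cont Ss))"
  proof (rule power_sum_functional_card)
    show "e_coeff la \<alpha> = card {x \<in> X. cont x = \<alpha>}" for \<alpha>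
      unfolding e_coeff_def X_def cont_def fun_eq_iff by (rule arg_cong[where f = card]) auto
  qed (use eq finite_class_tuples in simp)
  then show ?thesis
    unfolding eq by (simp add: weight_def cont_def)
qed

text \<open>Every set holds all or none of the \<open>mu ! i\<close> colours of class
  \<open>i\<close>, while the sets together hold exactly \<open>mu ! i\<close> of them with
  multiplicity. So exactly one set holds the class.\<close>

lemma block_tuple_covers_once:
  assumes "Ss \<in> block_tuples la" "c \<in> colours"
  shows "card {j. j < length la \<and> c \<in> Ss ! j} = 1"
proof -
  let ?i = "cls c" and ?J = "{j. j < length la \<and> c \<in> Ss ! j}"
  have i: "?i < length mu" using assms(2) by (simp add: mem_colours)
  have sub: "Ss ! j \<subseteq> colours" if "j < length la" for j
    using assms(1) that by (auto simp: block_tuples_def class_tuples_def)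
  have "card {d \<in> Ss ! j. cls d = ?i} = (if c \<in> Ss ! j then mu ! ?i else 0)" if j: "j < length la" for j
  proof -
    have fin: "finite {d \<in> Ss ! j. cls d = ?i}"
      using sub[OF j] by (auto intro: finite_subset[OF _ finite_colours])
    have "card {d \<in> Ss ! j. cls d = ?i} \<in> {0, mu ! ?i}"
      using assms(1) i j by (auto simp: block_tuples_def)
    moreover have "card {d \<in> Ss ! j. cls d = ?i} \<noteq> 0" if "c \<in> Ss ! j"
      using that fin by auto
    moreover have "c \<in> Ss ! j" if "card {d \<in> Ss ! j. cls d = ?i} = mu ! ?i"
    proof -
      have "{d \<in> Ss ! j. cls d = ?i} = {d \<in> colours. cls d = ?i}"
        using that sub[OF j] card_class[OF i] by (intro card_subset_eq) auto
      then show ?thesis using assms(2) by auto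
    qed
    ultimately show ?thesis by auto
  qed
  then have "(\<Sum>j<length la. card {d \<in> Ss ! j. cls d = ?i})
      = (\<Sum>j<length la. if c \<in> Ss ! j then mu ! ?i else 0)"
    by (intro sum.cong) auto
  also have "\<dots> = card ?J * mu ! ?i"
    by (simp add: sum.If_cases Int_def)
  finally have "card ?J * mu ! ?i = mu ! ?i"
    using assms(1) i by (auto simp: block_tuples_def class_tuples_def)
  then show ?thesis
    using nth_mu_pos[OF i] by simp
qed

text \<open>Rotating the colours of class \<open>i\<close> in the \<open>j\<close>-th set kills all tuples in which that set contains
  some but not all colours of class \<open>i\<close>.\<close>
lemma power_sum_functional_e:
  "power_sum_functional (e_coeff la) = of_nat (card (block_tuples la)) * (\<Prod>c\<in>colours. wt c)"
proof -
  let ?T = "class_tuples la" and ?B = "block_tuples la"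
  let ?h = "\<lambda>Ss. \<Prod>c\<in>colours. wt c ^ card {j. j < length la \<and> c \<in> Ss ! j}"
  let ?g = "\<lambda>Ss. \<Prod>j<length la. \<Prod>c\<in>Ss ! j. wt c"
  \<comment> \<open>The pattern records how many colours of each class every set contains. It is
    invariant under rotation, and tuples with a common pattern can all be rotated in the same set
    and class.\<close>
  define pat where "pat = map (\<lambda>S i. card {c \<in> S. cls c = i} :: nat)"
  have hg: "?h Ss = ?g Ss" if "Ss \<in> ?T" for Ss
  proof -
    have "?h Ss = (\<Prod>c\<in>colours. \<Prod>j | j \<in> {..<length la} \<and> c \<in> Ss ! j. wt c)"
      by simp
    also have "\<dots> = (\<Prod>j<length la. \<Prod>c | c \<in> colours \<and> c \<in> Ss ! j. wt c)"
      by (rule prod.swap_restrict) auto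
    also have "\<dots> = ?g Ss"
      using that by (intro prod.cong refl) (auto simp: class_tuples_def)
    finally show ?thesis .
  qed
  have "sum ?g {Ss \<in> ?T - ?B. pat Ss = p} = 0" if p: "p \<in> pat ` (?T - ?B)" for p
  proof -
    obtain S0 where S0: "S0 \<in> ?T" "S0 \<notin> ?B" "p = pat S0" using p by auto
    then have len: "length S0 = length la" by (auto simp: class_tuples_def)
    obtain j i where j: "j < length la" and i: "i < length mu"
      and ne: "card {c \<in> S0 ! j. cls c = i} \<notin> {0, mu ! i}"
      using S0 by (auto simp: block_tuples_def)
    \<comment> \<open>This count is the same for the whole group and lies strictly between 0 and
      \<open>mu ! i\<close>, so all its tuples pick up the same factor, different from 1.\<close>
    define k where "k = card {c \<in> S0 ! j. cls c = i}"
    have pat_nth: "card {c \<in> Ss ! j'. cls c = i'} = card {c \<in> S0 ! j'. cls c = i'}"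
      if "Ss \<in> ?T" "pat Ss = p" "j' < length la" for Ss j' i'
    proof -
      have "pat Ss ! j' = (\<lambda>i. card {c \<in> Ss ! j'. cls c = i})"
        using that(1,3) by (simp add: pat_def class_tuples_def)
      moreover have "pat S0 ! j' = (\<lambda>i. card {c \<in> S0 ! j'. cls c = i})"
        using that(3) len by (simp add: pat_def)
      moreover have "pat Ss = pat S0" using that S0 by simp
      ultimately have "(\<lambda>i. card {c \<in> Ss ! j'. cls c = i}) = (\<lambda>i. card {c \<in> S0 ! j'. cls c = i})"
        by simp
      then show ?thesis by (rule fun_cong)
    qed
    have "S0 ! j \<subseteq> colours" using S0 j by (auto simp: class_tuples_def)
    then have "k \<le> mu ! i"
      unfolding k_def card_class[OF i, symmetric] by (intro card_mono) auto
    then have \<omega>: "cis (2 * pi / real (mu ! i)) ^ k \<noteq> 1"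
      using ne by (intro cis_root_power_neq_1) (auto simp: k_def)
    define \<phi> where "\<phi> = (\<lambda>Ss. Ss[j := rot i ` (Ss ! j)])"
    have rot_card: "card {c \<in> rot i ` S. cls c = i'} = card {c \<in> S. cls c = i'}"
      if "S \<subseteq> colours" for S i'
    proof -
      have "{c \<in> rot i ` S. cls c = i'} = rot i ` {c \<in> S. cls c = i'}" by auto
      then show ?thesis
        using that by (metis (no_types, lifting) card_image inj_on_rot inj_on_subset mem_Collect_eq subsetI subset_trans)
    qed
    have patT: "card {c \<in> \<phi> Ss ! j'. cls c = i'} = card {c \<in> Ss ! j'. cls c = i'}"
      if "Ss \<in> ?T" "j' < length la" for Ss j' i'
      using that rot_card[of "Ss ! j" i'] j
      by (cases "j' = j") (auto simp: \<phi>_def class_tuples_def)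
    have pat\<phi>: "pat (\<phi> Ss) = pat Ss" if "Ss \<in> ?T" for Ss
      using that patT[OF that] unfolding pat_def
      by (intro nth_equalityI) (auto simp: \<phi>_def class_tuples_def)
    have \<phi>T: "\<phi> Ss \<in> ?T" if "Ss \<in> ?T" for Ss
    proof -
      have sub: "Ss ! j' \<subseteq> colours" "card (Ss ! j') = la ! j'" if "j' < length la" for j'
        using \<open>Ss \<in> ?T\<close> that by (auto simp: class_tuples_def)
      have "\<phi> Ss ! j' \<subseteq> colours \<and> card (\<phi> Ss ! j') = la ! j'" if "j' < length la" for j'
      proof (cases "j' = j")
        case True
        have "card (rot i ` (Ss ! j)) = card (Ss ! j)"
          using sub(1)[OF j] inj_on_rot inj_on_subset by (intro card_image) blast
        then show ?thesis
          using True sub[OF j] j \<open>Ss \<in> ?T\<close> rot_in_colours by (auto simp: \<phi>_def class_tuples_def)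
      next
        case False
        then show ?thesis using sub[OF that] by (simp add: \<phi>_def)
      qed
      then show ?thesis
        using that patT[OF that] by (simp add: class_tuples_def) (simp add: \<phi>_def)
    qed
    have block_pat: "Ss \<in> ?B \<longleftrightarrow> (\<forall>j<length la. \<forall>i<length mu. card {c \<in> Ss ! j. cls c = i} \<in> {0, mu ! i})"
      if "Ss \<in> ?T" for Ss
      using that by (simp add: block_tuples_def)
    show ?thesis
    proof (rule sum_eq_0_if_twisted[OF _ _ _ _ \<omega>])
      show "finite {Ss \<in> ?T - ?B. pat Ss = p}" using finite_class_tuples by simp
      show "\<phi> ` {Ss \<in> ?T - ?B. pat Ss = p} \<subseteq> {Ss \<in> ?T - ?B. pat Ss = p}"
      proof -
        \<comment> \<open>Being a block tuple depends only on the class counts, so rotation stays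
          outside \<open>?B\<close>.\<close>
        have "\<phi> Ss \<in> ?B \<longleftrightarrow> Ss \<in> ?B" if "Ss \<in> ?T" for Ss
          using block_pat[OF that] block_pat[OF \<phi>T[OF that]] patT[OF that] by simp
        then show ?thesis using \<phi>T pat\<phi> by auto
      qed
      show "inj_on \<phi> {Ss \<in> ?T - ?B. pat Ss = p}"
      proof (rule inj_onI)
        fix Ss Ts assume Ss: "Ss \<in> {Ss \<in> ?T - ?B. pat Ss = p}" and Ts: "Ts \<in> {Ss \<in> ?T - ?B. pat Ss = p}"
          and eq: "\<phi> Ss = \<phi> Ts"
        have l: "length Ss = length la" "length Ts = length la"
          using Ss Ts by (auto simp: class_tuples_def)
        have sub: "Ss ! j \<subseteq> colours" "Ts ! j \<subseteq> colours"
          using Ss Ts j by (auto simp: class_tuples_def)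
        have "\<phi> Ss ! j = \<phi> Ts ! j" using eq by simp
        then have "rot i ` (Ss ! j) = rot i ` (Ts ! j)"
          using j l by (simp add: \<phi>_def)
        then have "Ss ! j = Ts ! j"
          using sub inj_on_rot inj_on_image_eq_iff by metis
        moreover have "Ss ! j' = Ts ! j'" if "j' \<noteq> j" for j'
          using arg_cong[OF eq, of "\<lambda>x. x ! j'"] that by (simp add: \<phi>_def)
        ultimately have "Ss ! j' = Ts ! j'" for j'
          by (cases "j' = j") auto
        then show "Ss = Ts"
          using l by (intro nth_equalityI) auto
      qed
      show "?g (\<phi> Ss) = cis (2 * pi / real (mu ! i)) ^ k * ?g Ss"
        if Ss: "Ss \<in> {Ss \<in> ?T - ?B. pat Ss = p}" for Ss
      proof -
        have sub: "Ss ! j \<subseteq> colours" using Ss j by (auto simp: class_tuples_def)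
        have l: "length Ss = length la" using Ss by (auto simp: class_tuples_def)
        have "(\<Prod>c\<in>\<phi> Ss ! j. wt c) = (\<Prod>c\<in>Ss ! j. wt (rot i c))"
          using j l inj_on_subset[OF inj_on_rot sub] by (simp add: \<phi>_def prod.reindex)
        also have "\<dots> = cis (2 * pi / real (mu ! i)) ^ k * (\<Prod>c\<in>Ss ! j. wt c)"
          using prod_wt_rot[OF sub] pat_nth[of Ss j i] Ss j by (simp add: k_def)
        finally have 1: "(\<Prod>c\<in>\<phi> Ss ! j. wt c) = cis (2 * pi / real (mu ! i)) ^ k * (\<Prod>c\<in>Ss ! j. wt c)" .
        have "?g (\<phi> Ss) = (\<Prod>c\<in>\<phi> Ss ! j. wt c) * (\<Prod>j'\<in>{..<length la} - {j}. \<Prod>c\<in>\<phi> Ss ! j'. wt c)"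
          using j by (intro prod.remove) auto
        also have "(\<Prod>j'\<in>{..<length la} - {j}. \<Prod>c\<in>\<phi> Ss ! j'. wt c)
            = (\<Prod>j'\<in>{..<length la} - {j}. \<Prod>c\<in>Ss ! j'. wt c)"
          by (intro prod.cong) (auto simp: \<phi>_def)
        also have "(\<Prod>c\<in>\<phi> Ss ! j. wt c) * \<dots> = cis (2 * pi / real (mu ! i)) ^ k * ?g Ss"
          unfolding 1 using j by (subst (2) prod.remove[of _ j]) (auto simp: mult.assoc)
        finally show ?thesis .
      qed
    qed
  qed
  then have "sum ?g (?T - ?B) = 0"
    using finite_class_tuples by (subst sum.image_gen[of _ _ pat]) auto
  moreover have "?B \<subseteq> ?T" by (auto simp: block_tuples_def)
  ultimately have "sum ?g ?T = sum ?g ?B"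
    using sum.subset_diff[of ?B ?T ?g] finite_class_tuples by simp
  also have "\<dots> = sum ?h ?B"
    using \<open>?B \<subseteq> ?T\<close> by (intro sum.cong) (auto simp: hg subset_iff)
  \<comment> \<open>In a block tuple every colour occurs in exactly one set, so all block tuples
    have the same weight.\<close>
  also have "\<dots> = (\<Sum>Ss\<in>?B. \<Prod>c\<in>colours. wt c)"
    by (intro sum.cong prod.cong refl) (metis block_tuple_covers_once power_one_right)
  finally show ?thesis
    by (simp add: power_sum_functional_e_sum hg)
qed

lemma prod_wt_nonzero: "(\<Prod>c\<in>colours. wt c) \<noteq> 0"
  by (simp add: wt_def)

section \<open>From e-positivity to connected partitions\<close>

text \<open>By linearity; the product of all \<open>wt c\<close> does not depend on
  \<open>la\<close> and factors out, leaving a sum of real numbers whose signs are those of the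
  coefficients.\<close>

lemma power_sum_functional_expansion:
  assumes "\<And>\<alpha>. real (f \<alpha>) = (\<Sum>la\<in>P. c la * real (e_coeff la \<alpha>))"
  shows "power_sum_functional f =
    of_real (\<Sum>la\<in>P. c la * real (card (block_tuples la))) * (\<Prod>c\<in>colours. wt c)"
proof -
  have f: "of_nat (f \<alpha>) = (\<Sum>la\<in>P. of_real (c la) * of_nat (e_coeff la \<alpha>) :: complex)" for \<alpha>
    using arg_cong[OF assms[of \<alpha>], of complex_of_real] by simp
  have "power_sum_functional f
      = (\<Sum>\<alpha>\<in>admissible. \<Sum>la\<in>P. of_real (c la) * (of_nat (e_coeff la \<alpha>) * weight \<alpha>))"
    by (simp add: power_sum_functional_def f sum_distrib_right mult.assoc)
  also have "\<dots> = (\<Sum>la\<in>P. of_real (c la) * power_sum_functional (e_coeff la))"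
    by (subst sum.swap) (simp add: power_sum_functional_def sum_distrib_left)
  also have "\<dots> = of_real (\<Sum>la\<in>P. c la * real (card (block_tuples la))) * (\<Prod>c\<in>colours. wt c)"
    by (simp add: power_sum_functional_e sum_distrib_right mult.assoc)
  finally show ?thesis .
qed

lemma finite_block_tuples: "finite (block_tuples la)"
  by (rule finite_subset[OF _ finite_class_tuples]) (auto simp: block_tuples_def)

lemma card_block_tuples_one_part: "0 < card (block_tuples [sum_list mu])"
proof -
  have "[colours] \<in> block_tuples [sum_list mu]"
    by (simp add: block_tuples_def class_tuples_def card_colours card_class)
  then show ?thesis
    using finite_block_tuples by (auto simp: card_gt_0_iff)
qed

end

text \<open>With a single class of \<open>n\<close> colours, every set is empty or contains all
  colours. As parts are positive, each equals \<open>n\<close>, and the total leaves room for only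
  one.\<close>

lemma block_tuples_single_class:
  assumes "0 < n" "la \<in> partitions n" "Ss \<in> composition.block_tuples [n] la"
  shows "la = [n]"
proof -
  interpret composition "[n]"
    by standard (use assms(1) in auto)
  have "la ! j = n" if j: "j < length la" for j
  proof -
    have "Ss ! j \<subseteq> colours" "card (Ss ! j) = la ! j"
      using assms(3) j by (auto simp: block_tuples_def class_tuples_def)
    moreover from this have "{c \<in> Ss ! j. cls c = 0} = Ss ! j"
      by (auto simp: mem_colours)
    ultimately have "la ! j \<in> {0, n}"
      using assms(3) j by (auto simp: block_tuples_def)
    moreover have "0 < la ! j"
      using assms(2) j by (simp add: partitions_def)
    ultimately show ?thesis by simp
  qed
  then have la: "la = replicate (length la) n"
    by (intro nth_equalityI) auto
  have "sum_list la = n"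
    using assms(2) by (simp add: partitions_def)
  then have "length la * n = n"
    using arg_cong[OF la, of sum_list] by (simp add: sum_list_replicate)
  then show ?thesis
    using la assms(1) by simp
qed

text \<open>Only \<open>e\<^sub>n\<close> involves \<open>p\<^sub>n\<close>, so if \<open>p\<^sub>n\<close> occurs in an \<open>e\<close>-positive function then so does \<open>e\<^sub>n\<close>.
  As \<open>p\<^sub>\<mu>\<close> occurs in all \<open>e\<^sub>\<lambda>\<close> with the same sign, it cannot cancel.\<close>
lemma e_positive_functional_nonzero:
  assumes "e_positive V E" "finite V" "V \<noteq> {}"
    and "composition.power_sum_functional [card V] (csf_coeff V E) \<noteq> 0"
    and "composition mu" "sum_list mu = card V"
  shows "composition.power_sum_functional mu (csf_coeff V E) \<noteq> 0"
proof -
  let ?n = "card V" and ?P = "partitions (card V)"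
  have n: "0 < ?n" using assms(2,3) by (simp add: card_gt_0_iff)
  interpret single: composition "[?n]"
    by standard (use n in auto)
  interpret composition mu by fact
  obtain c where c: "\<And>la. la \<in> ?P \<Longrightarrow> 0 \<le> c la"
    "\<And>\<alpha>. real (csf_coeff V E \<alpha>) = (\<Sum>la\<in>?P. c la * real (e_coeff la \<alpha>))"
    using assms(1) unfolding e_positive_def by blast
  have "(\<Sum>la\<in>?P. c la * real (card (single.block_tuples la))) \<noteq> 0" (is "?s \<noteq> 0")
    using assms(4) unfolding single.power_sum_functional_expansion[OF c(2)]
    by (metis mult_zero_left of_real_0)
  then obtain la where "la \<in> ?P" "c la * real (card (single.block_tuples la)) \<noteq> 0"
    by (meson sum.neutral)
  moreover from this have "la = [?n]"
    using block_tuples_single_class[OF n] by (metis card.empty equals0I mult_eq_0_iff of_nat_0)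
  ultimately have pos: "[?n] \<in> ?P" "0 < c [?n]"
    using c(1)[of "[?n]"] by auto
  \<comment> \<open>A sum over an infinite set defaults to 0, so the nonzero \<open>?s\<close>
    already shows that \<open>?P\<close> is finite.\<close>
  have fin: "finite ?P"
    using \<open>?s \<noteq> 0\<close> by (meson sum.infinite)
  have "0 < c [?n] * real (card (block_tuples [?n]))"
    using pos card_block_tuples_one_part assms(6) by simp
  also have "\<dots> \<le> (\<Sum>la\<in>?P. c la * real (card (block_tuples la)))"
    using pos fin c(1) by (intro member_le_sum) auto
  finally show ?thesis
    unfolding power_sum_functional_expansion[OF c(2)] mult_eq_0_iff of_real_eq_0_iff
    using prod_wt_nonzero by (metis less_irrefl)
qed

text \<open>For the one-part type the colours run through all roots of unity of order
  \<open>card V\<close>, whose lower power sums vanish. Hence \<open>sum_tree_colourings\<close>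
  with all vertex weights 1 evaluates the functional to plus or minus \<open>card V\<close>.\<close>

lemma tree_functional_nonzero:
  fixes depth :: "'v \<Rightarrow> nat"
  assumes "finite V" "r \<in> V"
    and "\<And>v. v \<in> V \<Longrightarrow> v \<noteq> r \<Longrightarrow> par v \<in> V \<and> depth (par v) < depth v"
    and E: "\<And>u v. u \<in> V \<Longrightarrow> v \<in> V \<Longrightarrow> E u v \<longleftrightarrow> u \<noteq> r \<and> v = par u \<or> v \<noteq> r \<and> u = par v"
  shows "composition.power_sum_functional [card V] (csf_coeff V E) \<noteq> 0"
proof -
  let ?n = "card V"
  have n: "0 < ?n" using assms(1,2) by (auto simp: card_gt_0_iff)
  interpret composition "[?n]"
    by standard (use n in auto)
  let ?z = "cis (2 * pi / real ?n)"
  have cls0: "cls c = 0" if "c \<in> colours" for c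
    using that by (simp add: mem_colours)
  have "?z ^ ?n = 1"
    using n by (simp add: DeMoivre)
  then have 1: "wt c ^ ?n = 1" if "c \<in> colours" for c
    using cls0[OF that] by (simp add: wt_def flip: power_mult) (metis mult.commute power_mult power_one)
  have 2: "(\<Sum>c\<in>colours. wt c ^ k) = 0" if "0 < k" "k < ?n" for k
  proof (rule sum_eq_0_if_twisted)
    show "rot 0 ` colours \<subseteq> colours" using rot_in_colours by auto
    show "wt (rot 0 c) ^ k = ?z ^ k * wt c ^ k" if "c \<in> colours" for c
      using that cls0 by (simp add: wt_rot power_mult_distrib)
    show "?z ^ k \<noteq> 1" using that by (rule cis_root_power_neq_1)
  qed (auto simp: inj_on_rot)
  have "class_colourings V E = {\<kappa> \<in> V \<rightarrow>\<^sub>E colours. \<forall>v\<in>V - {r}. \<kappa> v \<noteq> \<kappa> (par v)}"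
  proof -
    have "proper_colouring V E \<kappa> \<longleftrightarrow> (\<forall>v\<in>V - {r}. \<kappa> v \<noteq> \<kappa> (par v))" for \<kappa>
    proof
      assume *: "proper_colouring V E \<kappa>"
      show "\<forall>v\<in>V - {r}. \<kappa> v \<noteq> \<kappa> (par v)"
      proof
        fix v assume "v \<in> V - {r}"
        then have "v \<in> V" "par v \<in> V" "E v (par v)" using assms(3)[of v] by (auto simp: E)
        with * show "\<kappa> v \<noteq> \<kappa> (par v)" by (auto simp: proper_colouring_def)
      qed
    next
      assume *: "\<forall>v\<in>V - {r}. \<kappa> v \<noteq> \<kappa> (par v)"
      show "proper_colouring V E \<kappa>"
        unfolding proper_colouring_def
      proof (intro ballI impI)
        fix u v assume "u \<in> V" "v \<in> V" "E u v"
        then show "\<kappa> u \<noteq> \<kappa> v"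
          using * E[of u v] by (metis DiffI singletonD)
      qed
    qed
    moreover have "{v \<in> V. cls (\<kappa> v) = 0} = V" if "\<kappa> \<in> V \<rightarrow>\<^sub>E colours" for \<kappa>
      using that cls0 by (auto simp: PiE_iff)
    ultimately show ?thesis
      by (auto simp: class_colourings_def)
  qed
  then have "power_sum_functional (csf_coeff V E)
      = (\<Sum>\<kappa> | \<kappa> \<in> V \<rightarrow>\<^sub>E colours \<and> (\<forall>v\<in>V - {r}. \<kappa> v \<noteq> \<kappa> (par v)). \<Prod>v\<in>V. wt (\<kappa> v) ^ 1)"
    by (simp add: power_sum_functional_csf[OF assms(1)])
  also have "\<dots> = (- 1) ^ (?n - 1) * of_nat (card colours)"
    by (rule sum_tree_colourings[where depth = depth and m = ?n]) (use assms(1-3) 1 2 in auto)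
  finally show ?thesis
    using n by (simp add: card_colours)
qed

text \<open>Wolfgang's theorem for a tree given by a root and a parent map; \<open>depth\<close>
  only serves to exclude cycles.\<close>

lemma e_positive_tree_connected_partition:
  fixes depth :: "'v \<Rightarrow> nat"
  assumes "e_positive V E" "finite V" "r \<in> V"
    and "\<And>v. v \<in> V \<Longrightarrow> v \<noteq> r \<Longrightarrow> par v \<in> V \<and> depth (par v) < depth v"
    and "\<And>u v. u \<in> V \<Longrightarrow> v \<in> V \<Longrightarrow> E u v \<longleftrightarrow> u \<noteq> r \<and> v = par u \<or> v \<noteq> r \<and> u = par v"
    and "\<And>u v. E u v \<Longrightarrow> E v u"
    and "\<forall>m\<in>set mu. 0 < m" "sum_list mu = card V"
  shows "\<exists>f. (\<forall>v\<in>V. f v < length mu) \<and> (\<forall>i<length mu. card {v \<in> V. f v = i} = mu ! i) \<and>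
    (\<forall>i<length mu. linked E {v \<in> V. f v = i})"
proof -
  interpret composition mu
    by standard (use assms(7) in auto)
  have "power_sum_functional (csf_coeff V E) \<noteq> 0"
  proof (rule e_positive_functional_nonzero)
    show "composition.power_sum_functional [card V] (csf_coeff V E) \<noteq> 0"
      using assms(2-5) by (rule tree_functional_nonzero)
  qed (use assms composition_axioms in auto)
  then show ?thesis
    using assms(2,6) by (intro connected_partition_if_functional_nonzero)
qed

section \<open>Connected pieces of spiders\<close>

lemma spider_V_eq:
  "spider_V lam = insert (0, 0) (SIGMA i:{1..length lam}. {1..lam ! (i - 1)})"
  by (auto simp: spider_V_def)

lemma finite_spider_V: "finite (spider_V lam)"
  by (simp add: spider_V_eq)

text \<open>Legs are numbered from 1 but list entries from 0, so \<open>drop j lam\<close> describes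
  the legs from \<open>Suc j\<close> on.\<close>

lemma card_legs:
  assumes "j \<le> length lam"
  shows "card (insert (0, 0) (SIGMA i:{Suc j..length lam}. {1..lam ! (i - 1)}))
    = 1 + sum_list (drop j lam)"
proof -
  have "card (SIGMA i:{Suc j..length lam}. {1..lam ! (i - 1)}) = (\<Sum>i = Suc j..length lam. lam ! (i - 1))"
    by simp
  also have "\<dots> = (\<Sum>i<length lam - j. lam ! (j + i))"
    by (rule sum.reindex_bij_witness[where i = "\<lambda>i. Suc (j + i)" and j = "\<lambda>i. i - Suc j"])
      (use assms in auto)
  also have "\<dots> = sum_list (drop j lam)"
    by (simp add: sum_list_sum_nth atLeast0LessThan)
  finally show ?thesis
    by (subst card_insert_disjoint) auto
qed

lemma card_spider_V: "card (spider_V lam) = 1 + sum_list lam"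
  using card_legs[of 0 lam] by (simp add: spider_V_eq)

lemma spider_connected_partition:
  assumes "e_positive (spider_V lam) (spider_E lam)"
    and "\<forall>m\<in>set mu. 0 < m" "sum_list mu = 1 + sum_list lam"
  shows "\<exists>f. (\<forall>v\<in>spider_V lam. f v < length mu) \<and>
    (\<forall>i<length mu. card {v \<in> spider_V lam. f v = i} = mu ! i) \<and>
    (\<forall>i<length mu. linked (spider_E lam) {v \<in> spider_V lam. f v = i})"
proof (rule e_positive_tree_connected_partition[OF assms(1) finite_spider_V])
  \<comment> \<open>The spider is rooted at its centre; the second coordinate is the distance from
    it.\<close>
  let ?par = "\<lambda>v :: nat \<times> nat. if snd v = 1 then (0, 0) else (fst v, snd v - 1)"
  show "(0, 0) \<in> spider_V lam" by (simp add: spider_V_def)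
  show "?par v \<in> spider_V lam \<and> snd (?par v) < snd v" if "v \<in> spider_V lam" "v \<noteq> (0, 0)" for v
    using that by (auto simp: spider_V_def)
  show "spider_E lam u v \<longleftrightarrow> u \<noteq> (0, 0) \<and> v = ?par u \<or> v \<noteq> (0, 0) \<and> u = ?par v"
    if "u \<in> spider_V lam" "v \<in> spider_V lam" for u v
    using that by (cases u; cases v) (auto simp: spider_V_def spider_E_def)
  show "spider_E lam v u" if "spider_E lam u v" for u v
    using that by (auto simp: spider_E_def)
qed (use assms card_spider_V in auto)

text \<open>Different legs are joined only through the centre, so a connected block that avoids the
  centre stays in one leg.\<close>

lemma block_off_centre_within_leg:
  assumes "linked (spider_E lam) B" "B \<subseteq> spider_V lam" "(0, 0) \<notin> B" "(p, q) \<in> B"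
  shows "B \<subseteq> {p} \<times> {1..lam ! (p - 1)}" "card B \<le> lam ! (p - 1)"
proof -
  have "{v \<in> B. fst v = p} = B"
  proof (rule ccontr)
    let ?A = "{v \<in> B. fst v = p}"
    assume "?A \<noteq> B"
    then have "?A \<noteq> {} \<and> ?A \<subset> B" using assms(4) by auto
    then have "\<exists>u\<in>?A. \<exists>v\<in>B - ?A. spider_E lam u v"
      using spec[OF assms(1)[unfolded linked_def], of ?A] by (rule mp[rotated])
    then obtain u v where uv: "u \<in> B" "fst u = p" "v \<in> B" "fst v \<noteq> p" "spider_E lam u v"
      by blast
    then have "u \<noteq> (0, 0)" "v \<noteq> (0, 0)" using assms(3) by auto
    with uv show False by (auto simp: spider_E_def)
  qed
  then have fst: "fst v = p" if "v \<in> B" for v using that by blast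
  show sub: "B \<subseteq> {p} \<times> {1..lam ! (p - 1)}"
  proof
    fix v assume "v \<in> B"
    then have "v \<in> spider_V lam" "v \<noteq> (0, 0)" "fst v = p"
      using assms(2,3) fst by auto
    then show "v \<in> {p} \<times> {1..lam ! (p - 1)}"
      by (cases v) (auto simp: spider_V_def)
  qed
  have "card B \<le> card ({p} \<times> {1..lam ! (p - 1)})"
    by (rule card_mono[OF _ sub]) simp
  then show "card B \<le> lam ! (p - 1)" by simp
qed

text \<open>If all parts exceed leg \<open>j\<close>, the block of the centre swallows that leg and all shorter ones.\<close>
lemma spider_part_bound:
  assumes "e_positive (spider_V lam) (spider_E lam)" "sorted_wrt (\<ge>) lam" "j < length lam"
    and "\<forall>m\<in>set mu. lam ! j < m" "sum_list mu = 1 + sum_list lam"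
  shows "\<exists>m\<in>set mu. sum_list (drop j lam) < m"
proof -
  have "\<forall>m\<in>set mu. 0 < m" using assms(4) by auto
  from spider_connected_partition[OF assms(1) this assms(5)] obtain f where
    f: "\<And>v. v \<in> spider_V lam \<Longrightarrow> f v < length mu"
       "\<And>i. i < length mu \<Longrightarrow> card {v \<in> spider_V lam. f v = i} = mu ! i"
       "\<And>i. i < length mu \<Longrightarrow> linked (spider_E lam) {v \<in> spider_V lam. f v = i}"
    by blast
  have c: "(0, 0) \<in> spider_V lam" by (simp add: spider_V_def)
  let ?i = "f (0, 0)"
  have "insert (0, 0) (SIGMA p:{Suc j..length lam}. {1..lam ! (p - 1)}) \<subseteq> {v \<in> spider_V lam. f v = ?i}"
  proof clarify
    fix p q
    assume "(p, q) \<in> insert (0, 0) (SIGMA p:{Suc j..length lam}. {1..lam ! (p - 1)})"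
    moreover have "(p, q) \<in> spider_V lam \<and> f (p, q) = ?i"
      if pq: "p \<in> {Suc j..length lam}" "q \<in> {1..lam ! (p - 1)}"
    proof
      show V: "(p, q) \<in> spider_V lam" using pq by (auto simp: spider_V_def)
      show "f (p, q) = ?i"
      proof (rule ccontr)
        let ?B = "{v \<in> spider_V lam. f v = f (p, q)}"
        assume "f (p, q) \<noteq> ?i"
        then have "card ?B \<le> lam ! (p - 1)"
          using V by (intro block_off_centre_within_leg(2)[OF f(3)[OF f(1)[OF V]], of p q]) auto
        also have "\<dots> \<le> lam ! j"
          using sorted_wrt_nth_less[OF assms(2), of j "p - 1"] pq by (cases "p - 1 = j") auto
        also have "\<dots> < mu ! f (p, q)"
          using assms(4) f(1)[OF V] by simp
        finally show False using f(2)[OF f(1)[OF V]] by simp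
      qed
    qed
    ultimately show "(p, q) \<in> spider_V lam \<and> f (p, q) = ?i" using c by auto
  qed
  then have "card (insert (0, 0) (SIGMA p:{Suc j..length lam}. {1..lam ! (p - 1)}))
      \<le> card {v \<in> spider_V lam. f v = ?i}"
    using finite_spider_V by (intro card_mono) auto
  then have "1 + sum_list (drop j lam) \<le> mu ! ?i"
    using card_legs[of j lam] assms(3) f(2)[OF f(1)[OF c]] by simp
  then show ?thesis
    using f(1)[OF c] by (intro bexI[of _ "mu ! ?i"]) auto
qed

text \<open>Cut the spider into two connected pieces of nearly equal size. The piece without the
  centre has at least \<open>n div 2\<close> vertices and fits into a single leg.\<close>

lemma spider_longest_leg:
  assumes "e_positive (spider_V lam) (spider_E lam)" "sorted_wrt (\<ge>) lam" "0 < sum_list lam"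
  shows "(1 + sum_list lam) div 2 \<le> lam ! 0"
proof -
  let ?n = "1 + sum_list lam"
  let ?mu = "[?n div 2, ?n - ?n div 2]"
  have "\<forall>m\<in>set ?mu. 0 < m" "sum_list ?mu = 1 + sum_list lam"
    using assms(3) by auto
  from spider_connected_partition[OF assms(1) this] obtain f where
    f: "\<And>v. v \<in> spider_V lam \<Longrightarrow> f v < length ?mu"
       "\<And>i. i < length ?mu \<Longrightarrow> card {v \<in> spider_V lam. f v = i} = ?mu ! i"
       "\<And>i. i < length ?mu \<Longrightarrow> linked (spider_E lam) {v \<in> spider_V lam. f v = i}"
    by blast
  \<comment> \<open>The index of the piece that does not contain the centre.\<close>
  define i where "i = (if f (0, 0) = 0 then 1 else 0 :: nat)"
  let ?B = "{v \<in> spider_V lam. f v = i}"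
  have i: "i < length ?mu" "i \<noteq> f (0, 0)"
    by (auto simp: i_def)
  have B: "?n div 2 \<le> card ?B"
    using f(2)[OF i(1)] i(1) by (cases i) auto
  moreover have "0 < ?n div 2" using assms(3) by auto
  ultimately obtain v where "v \<in> ?B"
    by (metis (no_types, lifting) card.empty ex_in_conv not_le)
  then obtain p q where pq: "(p, q) \<in> ?B" by (cases v) auto
  then have "card ?B \<le> lam ! (p - 1)"
    using i by (intro block_off_centre_within_leg(2)[OF f(3), of _ p q]) auto
  also have "\<dots> \<le> lam ! 0"
    using pq i sorted_wrt_nth_less[OF assms(2), of 0 "p - 1"]
    by (cases "p - 1 = 0") (auto simp: spider_V_def)
  finally show ?thesis using B by simp
qed

section \<open>Inequalities between leg lengths\<close>

text \<open>If the bound failed, the number of vertices would be a sum of parts between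
  \<open>?a + 1\<close> and \<open>?a + 1 + ?p\<close>. But \<open>spider_part_bound\<close> demands
  a part larger than the total of leg \<open>j\<close> and all later legs.\<close>

lemma leg_square_bound:
  assumes "e_positive (spider_V lam) (spider_E lam)" "sorted_wrt (\<ge>) lam"
    and "\<forall>x\<in>set lam. 0 < x" "Suc (Suc j) < length lam"
  shows "(1 + sum_list lam) * lam ! Suc j \<le> 2 * (lam ! j)\<^sup>2"
proof (rule ccontr)
  let ?n = "1 + sum_list lam" and ?a = "lam ! j" and ?p = "lam ! Suc j"
  assume "\<not> ?thesis"
  then have less: "2 * (?a * ?a) < ?n * ?p" by (simp add: power2_eq_square)
  have "?p \<le> ?a"
    using sorted_wrt_nth_less[OF assms(2), of j "Suc j"] assms(4) by simp
  \<comment> \<open>Otherwise \<open>?J * ?p\<close> is at most \<open>?a - 1\<close>; multiplying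
    \<open>?n \<le> ?J * (?a + 1) + ?a\<close> by \<open>?p\<close> then bounds
    \<open>?n * ?p\<close> by \<open>2 * (?a * ?a)\<close>, against \<open>less\<close>.\<close>
  have "?a \<le> (?n div (?a + 1)) * ?p"
  proof (rule ccontr)
    let ?J = "?n div (?a + 1)"
    assume "\<not> ?a \<le> ?J * ?p"
    then have J: "?J * ?p + 1 \<le> ?a" by simp
    have "?n = ?J * (?a + 1) + ?n mod (?a + 1)"
      by (simp only: div_mult_mod_eq)
    moreover have "?n mod (?a + 1) \<le> ?a"
      using mod_less_divisor[of "?a + 1" ?n] by linarith
    ultimately have "?n \<le> ?J * (?a + 1) + ?a" by linarith
    then have "?n * ?p \<le> (?J * (?a + 1) + ?a) * ?p"
      by (rule mult_right_mono) simp
    also have "\<dots> = (?J * ?p) * (?a + 1) + ?a * ?p"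
      by (simp only: algebra_simps)
    also have "\<dots> \<le> (?a - 1) * (?a + 1) + ?a * ?a"
      using J \<open>?p \<le> ?a\<close> by (intro add_mono mult_mono) auto
    also have "\<dots> \<le> 2 * (?a * ?a)"
      by (cases ?a) auto
    finally show False using less by simp
  qed
  then obtain mu where mu: "\<forall>x\<in>set mu. ?a + 1 \<le> x \<and> x \<le> ?a + 1 + ?p" "sum_list mu = ?n"
    using parts_in_interval by blast
  have "\<exists>m\<in>set mu. sum_list (drop j lam) < m"
    using mu assms(4) by (intro spider_part_bound[OF assms(1,2)]) auto
  \<comment> \<open>The third leg in the list has at least one vertex, which supplies the summand
    1.\<close>
  moreover have "?a + 1 + ?p \<le> sum_list (drop j lam)"
  proof -
    have "drop j lam = ?a # ?p # lam ! Suc (Suc j) # drop (Suc (Suc (Suc j))) lam"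
      using assms(4) by (simp add: Cons_nth_drop_Suc)
    moreover have "0 < lam ! Suc (Suc j)" using assms(3,4) by simp
    ultimately show ?thesis by simp
  qed
  ultimately show False using mu(1) by fastforce
qed

theorem theorem3p9:
  fixes lam :: "nat list"
  assumes "sorted_wrt (\<ge>) lam"
    and "\<forall>x\<in>set lam. 0 < x"
    and "length lam \<ge> 5"
    and "e_positive (spider_V lam) (spider_E lam)"
  shows "(\<Sum>k = 1..length lam - 3. (real (1 + sum_list lam) / 2) powr (- (1 / 2 ^ k))) < 1"
proof -
  let ?d = "length lam"
  define m where "m = real (1 + sum_list lam) / 2"
  \<comment> \<open>Dividing by \<open>m = n/2\<close> turns the square bound into
    \<open>y (Suc j) \<le> (y j)\<^sup>2\<close>.\<close>
  define y where "y j = real (lam ! j) / m" for j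
  have m: "0 < m" by (simp add: m_def)
  have y_sq: "y (Suc j) \<le> (y j)\<^sup>2" if "Suc (Suc j) < ?d" for j
  proof -
    have "real ((1 + sum_list lam) * lam ! Suc j) \<le> real (2 * (lam ! j)\<^sup>2)"
      using leg_square_bound[OF assms(4,1,2) that] by (simp only: of_nat_le_iff)
    then have "m * real (lam ! Suc j) \<le> (real (lam ! j))\<^sup>2"
      by (simp add: m_def algebra_simps)
    then show ?thesis
      using m by (simp add: y_def field_simps power2_eq_square)
  qed
  \<comment> \<open>The induction starts at the second shortest leg, index \<open>?d - 2\<close>,
    where \<open>y\<close> is at least \<open>1 / m\<close>. Each step moves to the preceding leg in
    the list and takes a square root.\<close>
  have y_ge: "m powr (- (1 / 2 ^ k)) \<le> y (?d - 2 - k)" if "k \<le> ?d - 2" for k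
    using that
  proof (induction k)
    case 0
    have "0 < lam ! (?d - 2)" using assms(2,3) by simp
    then show ?case
      using m by (simp add: y_def powr_minus divide_simps)
  next
    case (Suc k)
    let ?j = "?d - 2 - Suc k"
    have "(m powr (- (1 / 2 ^ Suc k)))\<^sup>2 = m powr (- (1 / 2 ^ k))"
      by (simp add: power2_eq_square flip: powr_add)
    also have "\<dots> \<le> y (?d - 2 - k)" using Suc by simp
    also have "?d - 2 - k = Suc ?j" using Suc.prems by simp
    also have "y (Suc ?j) \<le> (y ?j)\<^sup>2"
      using Suc.prems by (intro y_sq) simp
    finally show ?case
      by (rule power2_le_imp_le) (use m in \<open>simp add: y_def\<close>)
  qed
  have "(\<Sum>k = 1..?d - 3. m powr (- (1 / 2 ^ k))) \<le> (\<Sum>k = 1..?d - 3. y (?d - 2 - k))"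
    by (intro sum_mono y_ge) auto
  \<comment> \<open>The indices \<open>1\<close> to \<open>?d - 3\<close> leave out the longest leg
    and the last two legs.\<close>
  also have "\<dots> = (\<Sum>j = 1..?d - 3. y j)"
    by (rule sum.reindex_bij_witness[where i = "\<lambda>j. ?d - 2 - j" and j = "\<lambda>k. ?d - 2 - k"]) auto
  also have "\<dots> = real (\<Sum>j = 1..?d - 3. lam ! j) / m"
    by (simp add: y_def sum_divide_distrib)
  also have "\<dots> < 1"
  proof -
    have "lam ! 0 + (\<Sum>j = 1..?d - 3. lam ! j) = (\<Sum>j\<in>insert 0 {1..?d - 3}. lam ! j)"
      by simp
    also have "\<dots> \<le> (\<Sum>j<?d. lam ! j)"
      using assms(3) by (intro sum_mono2) auto
    also have "\<dots> = sum_list lam"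
      by (simp add: sum_list_sum_nth atLeast0LessThan)
    finally have sum: "lam ! 0 + (\<Sum>j = 1..?d - 3. lam ! j) \<le> sum_list lam" .
    have "lam ! 0 \<in> set lam" using assms(3) by (intro nth_mem) linarith
    then have "0 < lam ! 0" using assms(2) by simp
    then have "0 < sum_list lam" using sum by simp
    \<comment> \<open>The longest leg has at least \<open>n div 2\<close> of the
      \<open>n - 1\<close> vertices off the centre, so twice the rest is less than \<open>n\<close>
      for either parity.\<close>
    with sum spider_longest_leg[OF assms(4,1)]
    have "2 * (\<Sum>j = 1..?d - 3. lam ! j) < 1 + sum_list lam" by linarith
    moreover have "real a < real b / 2" if "2 * a < b" for a b :: nat
      using that by linarith
    ultimately have "real (\<Sum>j = 1..?d - 3. lam ! j) < m"
      unfolding m_def by blast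
    then show ?thesis using m by simp
  qed
  finally show ?thesis by (simp add: m_def)
qed

end
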